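(* Let $K$ be a closed subset of $\mathbb{R}^d$ and let $\mu\in\mathcal{M}(K)$. Let $\varphi^j:\mathbb{R}^d\to\mathbb{R}^{m_j}$, $j=1,\dots,r$, be polynomial mappings (all components in $\mathbb{R}[x_1,\dots,x_d]$) and let $\varphi=(\varphi^1,\dots,\varphi^r):\mathbb{R}^d\to\mathbb{R}^m$, where $m=m_1+\cdots+m_r$. If the restriction $\varphi:K\to\mathbb{R}^m$ is injective and all image measures $\varphi^1(\mu),\dots,\varphi^r(\mu)$ are strictly determinate, then $\mu$ is determinate on $K$.
   Context: $\mathcal{M}(\mathbb{R}^d)$ is the set of positive Borel measures $\mu$ on $\mathbb{R}^d$ such that $x^\alpha\in L^1(\mu)$ for all $\alpha\in\mathbb{N}_0^d$; for a closed set $K\subseteq\mathbb{R}^d$, $\mathcal{M}(K)$ is the set of $\mu\in\mathcal{M}(\mathbb{R}^d)$ with $\operatorname{supp}\mu\subseteq K$. Two measures $\mu,\nu\in\mathcal{M}(\mathbb{R}^d)$ are equivalent, $\mu\cong\nu$, if $\int p\,d\mu=\int p\,d\nu$ for all polynomials $p$. A measure $\mu\in\mathcal{M}(K)$ is determinate on $K$ if every $\nu\in\mathcal{M}(K)$ with $\nu\cong\mu$ equals $\mu$. A measure $\sigma\in\mathcal{M}(\mathbb{R}^l)$ is strictly determinate if it is determinate (on $\mathbb{R}^l$) and the polynomials $\mathbb{C}[y_1,\dots,y_l]$ are dense in $L^2(\sigma)$. For a Borel map $\psi:\mathbb{R}^d\to\mathbb{R}^l$, $\psi(\mu)$ denotes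 the image measure $\psi(\mu)(M)=\mu(\psi^{-1}(M))$. *)

theory Defs
  imports "HOL-Analysis.Analysis"
begin

text \<open>
  The dimensions of the target spaces form a finite family that the statement quantifies over, so
  they cannot be types.  All spaces \<open>\<real>\<^sup>n\<close> are therefore the \<^const>\<open>Euclidean_space\<close> \<open>n\<close> of the
  library: real sequences \<open>x\<close> with \<open>x i = 0\<close> for \<open>i \<ge> n\<close>, with the subspace topology.
\<close>

abbreviation Rn :: "nat \<Rightarrow> (nat \<Rightarrow> real) set" where
  "Rn n \<equiv> topspace (Euclidean_space n)"

definition borel_Rn :: "nat \<Rightarrow> (nat \<Rightarrow> real) measure" where
  "borel_Rn n = restrict_space borel (Rn n)"

lemma space_borel_Rn: "space (borel_Rn n) = Rn n"
  by (simp add: borel_Rn_def space_restrict_space)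

lemma sets_borel_Rn: "sets (borel_Rn n) = sigma_sets (Rn n) {U. openin (Euclidean_space n) U}"
proof -
  have "{U. openin (Euclidean_space n) U} = (\<inter>) (Rn n) ` {S. open S}"
    by (auto simp: Euclidean_space_def euclidean_product_topology openin_subtopology)
  moreover have "Rn n \<in> sigma_sets UNIV {S. open S}"
    using closedin_Euclidean_imp_closed[OF closedin_topspace, of n]
    by (simp add: borel_closed flip: sets_borel)
  then have "sets (borel_Rn n) = sigma_sets (Rn n) ((\<inter>) (Rn n) ` {S. open S})"
    by (simp add: borel_Rn_def sets_restrict_space sets_borel sigma_sets_Int)
  ultimately show ?thesis
    by simp
qed

definition monomial_fun :: "nat \<Rightarrow> (nat \<Rightarrow> nat) \<Rightarrow> (nat \<Rightarrow> real) \<Rightarrow> real" where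
  "monomial_fun n \<alpha> x = (\<Prod>i<n. x i ^ \<alpha> i)"

text \<open>Polynomial functions of the variables \<open>x 0, \<dots>, x (n - 1)\<close> with coefficients in \<open>'a\<close>.\<close>

definition polys :: "nat \<Rightarrow> ((nat \<Rightarrow> real) \<Rightarrow> 'a::real_normed_field) set" where
  "polys n = {p. \<exists>A c. finite A \<and> p = (\<lambda>x. \<Sum>\<alpha>\<in>A. c \<alpha> * of_real (monomial_fun n \<alpha> x))}"

definition poly_map :: "nat \<Rightarrow> nat \<Rightarrow> ((nat \<Rightarrow> real) \<Rightarrow> nat \<Rightarrow> real) \<Rightarrow> bool" where
  "poly_map n l \<psi> \<longleftrightarrow> \<psi> \<in> Rn n \<rightarrow> Rn l \<and>
     (\<forall>i<l. \<exists>p \<in> (polys n :: ((nat \<Rightarrow> real) \<Rightarrow> real) set). \<forall>x \<in> Rn n. \<psi> x i = p x)"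

text \<open>
  Concatenation of \<open>v 0, \<dots>, v (r - 1)\<close>, where \<open>v j\<close> has \<open>m j\<close> components, to a vector with
  \<open>m 0 + \<dots> + m (r - 1)\<close> components.
\<close>

definition concat_vec :: "nat \<Rightarrow> (nat \<Rightarrow> nat) \<Rightarrow> (nat \<Rightarrow> nat \<Rightarrow> real) \<Rightarrow> nat \<Rightarrow> real" where
  "concat_vec r m v =
     (\<lambda>k. if k < (\<Sum>j<r. m j) then concat (map (\<lambda>j. map (v j) [0..<m j]) [0..<r]) ! k else 0)"

lemma length_concat_blocks:
  "length (concat (map (\<lambda>j. map (v j) [0..<m j]) [0..<r])) = (\<Sum>j<r. m j)" for m :: "nat \<Rightarrow> nat"
  by (induction r) auto

lemma concat_vec_block:
  assumes "j < r" "i < m j"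
  shows "concat_vec r m v ((\<Sum>k<j. m k) + i) = v j i"
  using assms(1)
proof (induction r)
  case (Suc r)
  let ?xs = "concat (map (\<lambda>j. map (v j) [0..<m j]) [0..<r])"
  show ?case
  proof (cases "j = r")
    case True
    then show ?thesis
      using assms(2) length_concat_blocks[of v m r] by (simp add: concat_vec_def nth_append)
  next
    case False
    then have "j < r"
      using Suc.prems by simp
    then have "(\<Sum>k<Suc j. m k) \<le> (\<Sum>k<r. m k)"
      by (intro sum_mono2) auto
    then have "(\<Sum>k<j. m k) + i < (\<Sum>k<r. m k)"
      using assms(2) by simp
    then show ?thesis
      using Suc.IH[OF \<open>j < r\<close>] length_concat_blocks[of v m r]
      by (simp add: concat_vec_def nth_append)
  qed
qed simp

definition msupp :: "nat \<Rightarrow> (nat \<Rightarrow> real) measure \<Rightarrow> (nat \<Rightarrow> real) set" where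
  "msupp n \<mu> = {x \<in> Rn n. \<forall>U. openin (Euclidean_space n) U \<and> x \<in> U \<longrightarrow> emeasure \<mu> U > 0}"

definition moment_measures :: "nat \<Rightarrow> (nat \<Rightarrow> real) measure set" where
  "moment_measures n =
     {\<mu>. sets \<mu> = sets (borel_Rn n) \<and> (\<forall>\<alpha>. integrable \<mu> (monomial_fun n \<alpha>))}"

definition moment_measures_on :: "nat \<Rightarrow> (nat \<Rightarrow> real) set \<Rightarrow> (nat \<Rightarrow> real) measure set" where
  "moment_measures_on n K = {\<mu> \<in> moment_measures n. msupp n \<mu> \<subseteq> K}"

definition moment_equiv ::
    "nat \<Rightarrow> (nat \<Rightarrow> real) measure \<Rightarrow> (nat \<Rightarrow> real) measure \<Rightarrow> bool" where
  "moment_equiv n \<mu> \<nu> \<longleftrightarrow>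
     (\<forall>p \<in> (polys n :: ((nat \<Rightarrow> real) \<Rightarrow> complex) set). (\<integral>x. p x \<partial>\<mu>) = (\<integral>x. p x \<partial>\<nu>))"

definition determinate_on :: "nat \<Rightarrow> (nat \<Rightarrow> real) set \<Rightarrow> (nat \<Rightarrow> real) measure \<Rightarrow> bool" where
  "determinate_on n K \<mu> \<longleftrightarrow> \<mu> \<in> moment_measures_on n K \<and>
     (\<forall>\<nu> \<in> moment_measures_on n K. moment_equiv n \<nu> \<mu> \<longrightarrow> \<nu> = \<mu>)"

definition polys_dense_L2 :: "nat \<Rightarrow> (nat \<Rightarrow> real) measure \<Rightarrow> bool" where
  "polys_dense_L2 n \<sigma> \<longleftrightarrow>
     (\<forall>f :: (nat \<Rightarrow> real) \<Rightarrow> complex.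
        f \<in> borel_measurable \<sigma> \<and> integrable \<sigma> (\<lambda>y. (cmod (f y))\<^sup>2) \<longrightarrow>
        (\<forall>\<epsilon>>0. \<exists>p \<in> polys n. sqrt (\<integral>y. (cmod (f y - p y))\<^sup>2 \<partial>\<sigma>) < \<epsilon>))"

definition strictly_determinate :: "nat \<Rightarrow> (nat \<Rightarrow> real) measure \<Rightarrow> bool" where
  "strictly_determinate n \<sigma> \<longleftrightarrow> determinate_on n (Rn n) \<sigma> \<and> polys_dense_L2 n \<sigma>"

end

theory Submission
  imports Defs
begin

text \<open>
  Let \<open>\<nu>\<close> be a measure on \<open>K\<close> that is equivalent to \<open>\<mu>\<close>.  Composition with a polynomial map carries
  polynomials to polynomials, so each image of \<open>\<nu>\<close> under \<open>\<phi> j\<close> is equivalent to that of \<open>\<mu>\<close>, and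
  determinacy makes the two images the same measure \<open>\<sigma> j\<close> (\<open>determinate_image_unique\<close>).  This says
  nothing yet about the joint distribution of the blocks \<open>\<phi> 0, \<dots>, \<phi> (r - 1)\<close>.

  The joint distribution is controlled by density.  A polynomial that is close to a bounded function
  \<open>f\<close> in \<open>L\<^sup>2\<close> of \<open>\<sigma> j\<close> is, after composition with \<open>\<phi> j\<close>, a polynomial that is close to \<open>f \<circ> \<phi> j\<close> in
  \<open>L\<^sup>2(\<mu>)\<close> and in \<open>L\<^sup>2(\<nu>)\<close> at the same time.  In an integral the polynomial may therefore be exchanged
  for the bounded function without losing the equality of the integrals over \<open>\<mu>\<close> and \<open>\<nu>\<close>.  An
  approximation of all blocks at once would produce products of \<open>r\<close> functions that are merely square
  integrable; instead the blocks are treated one after the other, next to an arbitrary polynomial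
  factor and the bounded factors already obtained (\<open>integral_eq_insert_factor\<close>).  For indicators this
  gives equal masses on all boxes, hence equal joint images (\<open>joint_image_unique\<close>).

  It remains to recover \<open>\<mu>\<close> from its image under the joint map \<open>\<Phi>\<close>.  Both measures live on \<open>K\<close>
  (\<open>AE_in_closed_superset_of_support\<close>).  For closed \<open>C\<close> the set \<open>\<Phi>(C \<inter> K)\<close> is a countable union of
  compact sets, hence Borel (\<open>borel_image_closed\<close>), and injectivity shows that its preimage meets \<open>K\<close>
  exactly in \<open>C \<inter> K\<close>.  So \<open>\<mu>\<close> and \<open>\<nu>\<close> agree on closed sets, which generate the Borel sets.
\<close>


section \<open>Polynomial functions\<close>

lemma polys_term: "(\<lambda>x. c * of_real (monomial_fun n \<alpha> x)) \<in> polys n"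
  unfolding polys_def by (auto intro!: exI[of _ "{\<alpha>}"] exI[of _ "\<lambda>_. c"])

lemma polys_const: "(\<lambda>x. c) \<in> polys n"
  using polys_term[of c n "\<lambda>_. 0"] by (simp add: monomial_fun_def)

lemma polys_monomial_fun: "monomial_fun n \<alpha> \<in> polys n"
  using polys_term[of "1::real" n \<alpha>] by simp

lemma polys_add:
  assumes "p \<in> polys n" "q \<in> polys n"
  shows "(\<lambda>x. p x + q x) \<in> polys n"
proof -
  obtain A c where A: "finite A" "p = (\<lambda>x. \<Sum>\<alpha>\<in>A. c \<alpha> * of_real (monomial_fun n \<alpha> x))"
    using assms(1) unfolding polys_def by blast
  obtain B e where B: "finite B" "q = (\<lambda>x. \<Sum>\<alpha>\<in>B. e \<alpha> * of_real (monomial_fun n \<alpha> x))"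
    using assms(2) unfolding polys_def by blast
  let ?c = "\<lambda>\<alpha>. (if \<alpha> \<in> A then c \<alpha> else 0) + (if \<alpha> \<in> B then e \<alpha> else 0)"
  have "p x + q x = (\<Sum>\<alpha>\<in>A \<union> B. ?c \<alpha> * of_real (monomial_fun n \<alpha> x))" for x
  proof -
    have "p x = (\<Sum>\<alpha>\<in>A \<union> B. (if \<alpha> \<in> A then c \<alpha> else 0) * of_real (monomial_fun n \<alpha> x))"
      unfolding A(2) using A(1) B(1) by (intro sum.mono_neutral_cong_left) auto
    moreover have "q x = (\<Sum>\<alpha>\<in>A \<union> B. (if \<alpha> \<in> B then e \<alpha> else 0) * of_real (monomial_fun n \<alpha> x))"
      unfolding B(2) using A(1) B(1) by (intro sum.mono_neutral_cong_left) auto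
    ultimately show ?thesis
      by (simp add: distrib_right sum.distrib)
  qed
  then show ?thesis
    unfolding polys_def using A(1) B(1) by (intro CollectI exI[of _ "A \<union> B"] exI[of _ ?c]) auto
qed

lemma polys_sum:
  assumes "\<And>i. i \<in> I \<Longrightarrow> p i \<in> polys n"
  shows "(\<lambda>x. \<Sum>i\<in>I. p i x) \<in> polys n"
  using assms
  by (induction I rule: infinite_finite_induct) (simp_all add: polys_const polys_add)

lemma polys_mult:
  assumes "p \<in> polys n" "q \<in> polys n"
  shows "(\<lambda>x. p x * q x) \<in> polys n"
proof -
  obtain A c where A: "p = (\<lambda>x. \<Sum>\<alpha>\<in>A. c \<alpha> * of_real (monomial_fun n \<alpha> x))"
    using assms(1) unfolding polys_def by blast
  obtain B e where B: "q = (\<lambda>x. \<Sum>\<alpha>\<in>B. e \<alpha> * of_real (monomial_fun n \<alpha> x))"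
    using assms(2) unfolding polys_def by blast
  have "monomial_fun n (\<lambda>i. \<alpha> i + \<beta> i) x = monomial_fun n \<alpha> x * monomial_fun n \<beta> x" for \<alpha> \<beta> x
    by (simp add: monomial_fun_def power_add prod.distrib)
  then have "c \<alpha> * of_real (monomial_fun n \<alpha> x) * (e \<beta> * of_real (monomial_fun n \<beta> x)) =
      c \<alpha> * e \<beta> * of_real (monomial_fun n (\<lambda>i. \<alpha> i + \<beta> i) x)" for \<alpha> \<beta> x
    by (simp add: mult_ac)
  then have "(\<lambda>x. p x * q x) =
      (\<lambda>x. \<Sum>\<alpha>\<in>A. \<Sum>\<beta>\<in>B. c \<alpha> * e \<beta> * of_real (monomial_fun n (\<lambda>i. \<alpha> i + \<beta> i) x))"
    unfolding A B sum_product by (simp only:)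
  then show ?thesis
    by (simp add: polys_sum polys_term)
qed

lemma polys_power: "p \<in> polys n \<Longrightarrow> (\<lambda>x. p x ^ k) \<in> polys n"
  by (induction k) (simp_all add: polys_const polys_mult)

lemma polys_prod:
  assumes "\<And>i. i \<in> I \<Longrightarrow> p i \<in> polys n"
  shows "(\<lambda>x. \<Prod>i\<in>I. p i x) \<in> polys n"
  using assms
  by (induction I rule: infinite_finite_induct) (simp_all add: polys_const polys_mult)

lemma polys_of_real:
  assumes "p \<in> polys n"
  shows "(\<lambda>x. of_real (p x)) \<in> polys n"
proof -
  obtain A c where "p = (\<lambda>x. \<Sum>\<alpha>\<in>A. c \<alpha> * of_real (monomial_fun n \<alpha> x))"
    using assms unfolding polys_def by blast
  then show ?thesis
    by (simp add: polys_sum polys_term)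
qed

text \<open>
  The pulled-back polynomial agrees with the composition on \<open>\<real>\<^sup>n\<close> only: a polynomial map is
  arbitrary at sequences outside that space.
\<close>

lemma polys_compose_poly_map:
  assumes "p \<in> polys l" "poly_map n l \<psi>"
  obtains q where "q \<in> polys n" "\<And>x. x \<in> Rn n \<Longrightarrow> p (\<psi> x) = q x"
proof -
  obtain A c where A: "p = (\<lambda>y. \<Sum>\<alpha>\<in>A. c \<alpha> * of_real (monomial_fun l \<alpha> y))"
    using assms(1) unfolding polys_def by blast
  have "\<forall>i. \<exists>P. i < l \<longrightarrow> P \<in> (polys n :: ((nat \<Rightarrow> real) \<Rightarrow> real) set) \<and> (\<forall>x\<in>Rn n. \<psi> x i = P x)"
    using assms(2) by (auto simp: poly_map_def)
  then obtain P where P: "\<And>i. i < l \<Longrightarrow> P i \<in> (polys n :: ((nat \<Rightarrow> real) \<Rightarrow> real) set)"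
    "\<And>i x. i < l \<Longrightarrow> x \<in> Rn n \<Longrightarrow> \<psi> x i = P i x"
    by metis
  show thesis
  proof (rule that)
    show "(\<lambda>x. \<Sum>\<alpha>\<in>A. c \<alpha> * of_real (\<Prod>i<l. P i x ^ \<alpha> i)) \<in> polys n"
      by (intro polys_sum polys_mult polys_const polys_of_real polys_prod polys_power P(1)) simp
    show "p (\<psi> x) = (\<Sum>\<alpha>\<in>A. c \<alpha> * of_real (\<Prod>i<l. P i x ^ \<alpha> i))" if "x \<in> Rn n" for x
      using that by (simp add: A monomial_fun_def P(2))
  qed
qed

lemma continuous_on_polys:
  assumes "p \<in> polys n"
  shows "continuous_on S p"
proof -
  obtain A c where "p = (\<lambda>x. \<Sum>\<alpha>\<in>A. c \<alpha> * of_real (monomial_fun n \<alpha> x))"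
    using assms unfolding polys_def by blast
  then show ?thesis
    by (auto simp: monomial_fun_def intro!: continuous_intros
        continuous_on_product_then_coordinatewise[OF continuous_on_id])
qed

lemma borel_measurable_polys: "p \<in> polys n \<Longrightarrow> p \<in> borel_measurable (borel_Rn n)"
  unfolding borel_Rn_def
  by (intro measurable_restrict_space1 borel_measurable_continuous_onI continuous_on_polys)

lemma continuous_on_poly_map_component:
  assumes "poly_map n l \<psi>" "i < l"
  shows "continuous_on (Rn n) (\<lambda>x. \<psi> x i)"
proof -
  obtain p :: "(nat \<Rightarrow> real) \<Rightarrow> real" where "p \<in> polys n" "\<And>x. x \<in> Rn n \<Longrightarrow> \<psi> x i = p x"
    using assms by (auto simp: poly_map_def)
  then show ?thesis
    using continuous_on_polys continuous_on_cong by metis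
qed

lemma measurable_borel_Rn_component: "(\<lambda>y. y i) \<in> borel_measurable (borel_Rn n)"
  unfolding borel_Rn_def
  by (rule measurable_restrict_space1, rule measurable_product_then_coordinatewise) simp

lemma measurable_poly_map:
  assumes "poly_map n l \<psi>"
  shows "\<psi> \<in> borel_Rn n \<rightarrow>\<^sub>M borel_Rn l"
proof -
  have \<psi>: "\<psi> \<in> Rn n \<rightarrow> Rn l"
    using assms by (simp only: poly_map_def)
  have "(\<lambda>x. \<psi> x i) \<in> borel_measurable (borel_Rn n)" for i
  proof (cases "i < l")
    case True
    then show ?thesis
      unfolding borel_Rn_def
      by (intro borel_measurable_continuous_on_restrict continuous_on_poly_map_component[OF assms])
  next
    case False
    have "\<psi> x \<in> Rn l" if "x \<in> space (borel_Rn n)" for x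
      using that \<psi> by (auto simp: space_borel_Rn)
    then have "\<psi> x i = 0" if "x \<in> space (borel_Rn n)" for x
      using that False by (simp add: topspace_Euclidean_space)
    then show ?thesis
      by (subst measurable_cong[where g = "\<lambda>_. 0"]) auto
  qed
  then have "\<psi> \<in> borel_measurable (borel_Rn n)"
    by (rule measurable_coordinatewise_then_product)
  then show ?thesis
    unfolding borel_Rn_def[of l]
    using \<psi> by (intro measurable_restrict_space2) (simp_all only: space_borel_Rn)
qed


section \<open>Measures with moments\<close>

lemma moment_measuresD:
  assumes "M \<in> moment_measures n"
  shows "sets M = sets (borel_Rn n)" "space M = Rn n"
  using assms sets_eq_imp_space_eq[of M "borel_Rn n"]
  by (auto simp: moment_measures_def space_borel_Rn)

lemma integrable_polys:
  fixes p :: "(nat \<Rightarrow> real) \<Rightarrow> 'a::{real_normed_field, banach, second_countable_topology}"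
  assumes "M \<in> moment_measures n" "p \<in> polys n"
  shows "integrable M p"
proof -
  obtain A c where "p = (\<lambda>x. \<Sum>\<alpha>\<in>A. c \<alpha> * of_real (monomial_fun n \<alpha> x))"
    using assms unfolding polys_def by blast
  then show ?thesis
    using assms(1) by (auto simp: moment_measures_def)
qed

lemma integrable_polys_square:
  fixes p :: "(nat \<Rightarrow> real) \<Rightarrow> complex"
  assumes "M \<in> moment_measures n" "p \<in> polys n"
  shows "integrable M (\<lambda>x. (cmod (p x))\<^sup>2)"
  using integrable_norm[OF integrable_polys[OF assms(1) polys_mult[OF assms(2,2)]]]
  by (simp add: norm_mult power2_eq_square)

lemma finite_measure_moment_measures:
  assumes "M \<in> moment_measures n"
  shows "finite_measure M"
proof
  have "integrable M (\<lambda>_. 1::real)"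
    using integrable_polys[OF assms polys_const[of "1::real"]] .
  then show "emeasure M (space M) \<noteq> \<infinity>"
    by (simp add: integrable_iff_bounded)
qed

lemma distr_poly_map_in_moment_measures:
  assumes "M \<in> moment_measures n" "poly_map n l \<psi>"
  shows "distr M (borel_Rn l) \<psi> \<in> moment_measures l"
proof -
  have meas: "\<psi> \<in> M \<rightarrow>\<^sub>M borel_Rn l"
    using measurable_poly_map[OF assms(2)] moment_measuresD(1)[OF assms(1)]
    by (simp cong: measurable_cong_sets)
  have "integrable (distr M (borel_Rn l) \<psi>) (monomial_fun l \<alpha>)" for \<alpha>
  proof -
    obtain q :: "(nat \<Rightarrow> real) \<Rightarrow> real"
      where q: "q \<in> polys n" "\<And>x. x \<in> Rn n \<Longrightarrow> monomial_fun l \<alpha> (\<psi> x) = q x"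
      using polys_compose_poly_map[OF polys_monomial_fun assms(2)] by metis
    have "integrable M (\<lambda>x. monomial_fun l \<alpha> (\<psi> x))"
      using integrable_polys[OF assms(1) q(1)] q(2) moment_measuresD(2)[OF assms(1)]
      by (subst Bochner_Integration.integrable_cong[OF refl, where g = q]) auto
    then show ?thesis
      by (simp add: integrable_distr_eq meas borel_measurable_polys polys_monomial_fun)
  qed
  then show ?thesis
    by (simp add: moment_measures_def)
qed

text \<open>
  Polynomials pull back to polynomials, so equivalent measures have equivalent images, and
  determinacy of one image identifies the two.
\<close>

lemma determinate_image_unique:
  assumes "\<mu> \<in> moment_measures n" "\<nu> \<in> moment_measures n" "moment_equiv n \<nu> \<mu>"
    and "poly_map n l \<psi>" "determinate_on l (Rn l) (distr \<mu> (borel_Rn l) \<psi>)"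
  shows "distr \<nu> (borel_Rn l) \<psi> = distr \<mu> (borel_Rn l) \<psi>"
proof -
  have meas: "\<psi> \<in> M \<rightarrow>\<^sub>M borel_Rn l" if "M \<in> moment_measures n" for M
    using measurable_poly_map[OF assms(4)] moment_measuresD(1)[OF that]
    by (simp cong: measurable_cong_sets)
  have "moment_equiv l (distr \<nu> (borel_Rn l) \<psi>) (distr \<mu> (borel_Rn l) \<psi>)"
    unfolding moment_equiv_def
  proof
    fix p :: "(nat \<Rightarrow> real) \<Rightarrow> complex"
    assume p: "p \<in> polys l"
    obtain q where q: "q \<in> polys n" "\<And>x. x \<in> Rn n \<Longrightarrow> p (\<psi> x) = q x"
      using polys_compose_poly_map[OF p assms(4)] by metis
    have "(\<integral>y. p y \<partial>distr M (borel_Rn l) \<psi>) = (\<integral>x. q x \<partial>M)" if "M \<in> moment_measures n" for M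
      unfolding integral_distr[OF meas[OF that] borel_measurable_polys[OF p]]
      using q(2) moment_measuresD(2)[OF that]
      by (intro Bochner_Integration.integral_cong) auto
    then show "(\<integral>y. p y \<partial>distr \<nu> (borel_Rn l) \<psi>) = (\<integral>y. p y \<partial>distr \<mu> (borel_Rn l) \<psi>)"
      using assms(1-3) q(1) by (simp add: moment_equiv_def)
  qed
  moreover have "distr \<nu> (borel_Rn l) \<psi> \<in> moment_measures_on l (Rn l)"
    using distr_poly_map_in_moment_measures[OF assms(2,4)]
    by (auto simp: moment_measures_on_def msupp_def)
  ultimately show ?thesis
    using assms(5) by (simp add: determinate_on_def)
qed

text \<open>
  Every point outside \<open>K\<close> has an open neighbourhood of measure zero, and by the Lindelof property
  countably many of these neighbourhoods suffice to cover the complement of \<open>K\<close>.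
\<close>

lemma AE_in_closed_superset_of_support:
  assumes "M \<in> moment_measures_on n K" "closedin (Euclidean_space n) K"
  shows "AE x in M. x \<in> K"
proof -
  have M: "M \<in> moment_measures n" "msupp n M \<subseteq> K"
    using assms(1) by (auto simp: moment_measures_on_def)
  define \<F> where "\<F> = {U. openin (Euclidean_space n) U \<and> emeasure M U = 0}"
  have "openin (top_of_set (Rn n)) U" if "U \<in> \<F>" for U
    using that
    by (auto simp: \<F>_def Euclidean_space_def euclidean_product_topology)
  then obtain \<G> where \<G>: "\<G> \<subseteq> \<F>" "countable \<G>" "\<Union>\<G> = \<Union>\<F>"
    by (rule Lindelof_openin)
  have "U \<in> null_sets M" if "U \<in> \<G>" for U
    using that \<G>(1) by (auto simp: \<F>_def null_sets_def moment_measuresD[OF M(1)] sets_borel_Rn)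
  then have "\<Union>\<G> \<in> null_sets M"
    using \<G>(2) null_sets_UN'[of \<G> id M] by simp
  moreover have "x \<in> \<Union>\<F>" if x: "x \<in> Rn n - K" for x
  proof -
    have "x \<notin> msupp n M"
      using x M(2) by blast
    then obtain U where "openin (Euclidean_space n) U" "x \<in> U" "\<not> emeasure M U > 0"
      using x by (auto simp: msupp_def)
    then show ?thesis
      by (auto simp: \<F>_def zero_less_iff_neq_zero)
  qed
  ultimately show ?thesis
    by (intro AE_I'[of "\<Union>\<G>"]) (auto simp: \<G>(3) moment_measuresD[OF M(1)])
qed

lemma measure_eqI_closed:
  assumes "M \<in> moment_measures n" "N \<in> moment_measures n"
    and "\<And>C. closedin (Euclidean_space n) C \<Longrightarrow> emeasure M C = emeasure N C"
  shows "M = N"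
proof -
  let ?E = "{C. closedin (Euclidean_space n) C}"
  have "sigma_sets (Rn n) {U. openin (Euclidean_space n) U} = sigma_sets (Rn n) ?E"
  proof (rule sigma_sets_eqI)
    fix U assume "U \<in> {U. openin (Euclidean_space n) U}"
    then have "Rn n - U \<in> ?E" "Rn n - (Rn n - U) = U"
      using openin_subset[of "Euclidean_space n" U] by auto
    then show "U \<in> sigma_sets (Rn n) ?E"
      by (metis sigma_sets.Basic sigma_sets.Compl)
  next
    fix C assume "C \<in> ?E"
    then have "Rn n - C \<in> {U. openin (Euclidean_space n) U}" "Rn n - (Rn n - C) = C"
      using closedin_subset[of "Euclidean_space n" C] by auto
    then show "C \<in> sigma_sets (Rn n) {U. openin (Euclidean_space n) U}"
      by (metis sigma_sets.Basic sigma_sets.Compl)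
  qed
  then have sets: "sets (borel_Rn n) = sigma_sets (Rn n) ?E"
    by (simp add: sets_borel_Rn)
  show ?thesis
  proof (rule measure_eqI_generator_eq[where E = ?E and \<Omega> = "Rn n" and A = "\<lambda>_. Rn n"])
    show "Int_stable ?E"
      by (auto simp: Int_stable_def)
    show "?E \<subseteq> Pow (Rn n)"
      using closedin_subset by auto
    show "emeasure M (Rn n) \<noteq> \<infinity>" for i :: nat
      using finite_measure.emeasure_finite[OF finite_measure_moment_measures[OF assms(1)]] by simp
  qed (use assms(3) sets in \<open>auto simp: moment_measuresD[OF assms(1)] moment_measuresD[OF assms(2)]\<close>)
qed


section \<open>From polynomials to bounded functions of one block\<close>

text \<open>
  The weighted inequality \<open>2ab \<le> ta\<^sup>2 + b\<^sup>2/t\<close> does the work of Cauchy-Schwarz: the choice of \<open>t\<close>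
  is left open to be matched to the size of the second integral.
\<close>

lemma integral_mult_weighted_bound:
  fixes u h :: "'a \<Rightarrow> complex"
  assumes "u \<in> borel_measurable M" "h \<in> borel_measurable M"
    and u: "integrable M (\<lambda>x. (cmod (u x))\<^sup>2)" and h: "integrable M (\<lambda>x. (cmod (h x))\<^sup>2)" and "t > 0"
  shows "integrable M (\<lambda>x. u x * h x)"
    and "cmod (\<integral>x. u x * h x \<partial>M) \<le> (t * (\<integral>x. (cmod (u x))\<^sup>2 \<partial>M) + (\<integral>x. (cmod (h x))\<^sup>2 \<partial>M) / t) / 2"
proof -
  let ?b = "\<lambda>x. (t * (cmod (u x))\<^sup>2 + (cmod (h x))\<^sup>2 / t) / 2"
  have b: "integrable M ?b"
    using u h by simp
  have bound: "cmod (u x * h x) \<le> ?b x" for x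
  proof -
    have "0 \<le> (t * cmod (u x) - cmod (h x))\<^sup>2 / t"
      using \<open>t > 0\<close> by simp
    also have "\<dots> = t * (cmod (u x))\<^sup>2 + (cmod (h x))\<^sup>2 / t - 2 * (cmod (u x) * cmod (h x))"
      using \<open>t > 0\<close> by (simp add: power2_eq_square field_simps)
    finally show ?thesis
      by (simp add: norm_mult)
  qed
  show int: "integrable M (\<lambda>x. u x * h x)"
  proof (rule Bochner_Integration.integrable_bound[OF b])
    show "AE x in M. norm (u x * h x) \<le> norm (?b x)"
      using bound order_trans[OF bound abs_ge_self] by (intro AE_I2) simp
  qed (use assms(1,2) in simp)
  have "cmod (\<integral>x. u x * h x \<partial>M) \<le> (\<integral>x. cmod (u x * h x) \<partial>M)"
    by simp
  also have "\<dots> \<le> (\<integral>x. ?b x \<partial>M)"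
    using int b bound by (intro integral_mono) auto
  also have "\<dots> = (t * (\<integral>x. (cmod (u x))\<^sup>2 \<partial>M) + (\<integral>x. (cmod (h x))\<^sup>2 \<partial>M) / t) / 2"
    using u h by simp
  finally show "cmod (\<integral>x. u x * h x \<partial>M)
      \<le> (t * (\<integral>x. (cmod (u x))\<^sup>2 \<partial>M) + (\<integral>x. (cmod (h x))\<^sup>2 \<partial>M) / t) / 2" .
qed

text \<open>
  If \<open>q\<close> is a polynomial close to \<open>f\<close> in \<open>L\<^sup>2\<close> of the common image measure, then \<open>q \<circ> \<psi>\<close> is a
  polynomial that is close to \<open>f \<circ> \<psi>\<close> both in \<open>L\<^sup>2(\<mu>)\<close> and in \<open>L\<^sup>2(\<nu>)\<close>.  The factor \<open>p g\<close> is square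
  integrable, so replacing \<open>f \<circ> \<psi>\<close> by \<open>q \<circ> \<psi>\<close> changes either integral little, and after the
  replacement the integrals coincide because \<open>p \<cdot> (q \<circ> \<psi>)\<close> is again a polynomial.  That the hypothesis
  and the conclusion both range over all polynomials lets the lemma be iterated.
\<close>

lemma integral_eq_insert_factor:
  fixes f g p :: "(nat \<Rightarrow> real) \<Rightarrow> complex"
  assumes \<mu>: "\<mu> \<in> moment_measures n" and \<nu>: "\<nu> \<in> moment_measures n"
    and \<psi>: "poly_map n l \<psi>"
    and image: "distr \<nu> (borel_Rn l) \<psi> = distr \<mu> (borel_Rn l) \<psi>"
    and dense: "polys_dense_L2 l (distr \<mu> (borel_Rn l) \<psi>)"
    and f: "f \<in> borel_measurable (borel_Rn l)" "\<And>y. cmod (f y) \<le> 1"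
    and g: "g \<in> borel_measurable (borel_Rn n)" "\<And>x. cmod (g x) \<le> 1"
    and eq: "\<And>p. p \<in> polys n \<Longrightarrow> (\<integral>x. p x * g x \<partial>\<nu>) = (\<integral>x. p x * g x \<partial>\<mu>)"
    and p: "p \<in> polys n"
  shows "(\<integral>x. p x * (g x * f (\<psi> x)) \<partial>\<nu>) = (\<integral>x. p x * (g x * f (\<psi> x)) \<partial>\<mu>)"
proof -
  define \<sigma> where "\<sigma> = distr \<mu> (borel_Rn l) \<psi>"
  define S where "S = (\<integral>x. (cmod (p x))\<^sup>2 \<partial>\<mu>) + (\<integral>x. (cmod (p x))\<^sup>2 \<partial>\<nu>)"
  have \<sigma>: "\<sigma> \<in> moment_measures l"
    unfolding \<sigma>_def by (rule distr_poly_map_in_moment_measures[OF \<mu> \<psi>])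
  have sets_\<sigma>[measurable_cong]: "sets \<sigma> = sets (borel_Rn l)"
    by (simp add: \<sigma>_def)
  note [measurable] = f(1) g(1)
  interpret \<sigma>: finite_measure \<sigma>
    by (rule finite_measure_moment_measures[OF \<sigma>])
  have f2: "integrable \<sigma> (\<lambda>y. (cmod (f y))\<^sup>2)"
    using f(2) by (intro \<sigma>.integrable_const_bound[where B = 1]) (auto simp: power_le_one)

  have replace: "integrable M (\<lambda>x. p x * (g x * f (\<psi> x)))"
    "cmod ((\<integral>x. p x * (g x * f (\<psi> x)) \<partial>M) - (\<integral>x. p x * (g x * q (\<psi> x)) \<partial>M))
      \<le> (t * (\<integral>x. (cmod (p x))\<^sup>2 \<partial>M) + (\<integral>y. (cmod (f y - q y))\<^sup>2 \<partial>\<sigma>) / t) / 2"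
    if M: "M \<in> moment_measures n" "distr M (borel_Rn l) \<psi> = \<sigma>" and q: "q \<in> polys l" and "t > 0"
    for M q t
  proof -
    have [measurable_cong]: "sets M = sets (borel_Rn n)"
      by (rule moment_measuresD[OF M(1)])
    have [measurable]: "\<psi> \<in> borel_Rn n \<rightarrow>\<^sub>M borel_Rn l" "p \<in> borel_measurable (borel_Rn n)"
      "q \<in> borel_measurable (borel_Rn l)"
      using \<psi> p q by (simp_all add: measurable_poly_map borel_measurable_polys)
    have p2: "integrable M (\<lambda>x. (cmod (p x))\<^sup>2)"
      by (rule integrable_polys_square[OF M(1) p])
    have pg: "(cmod (p x * g x))\<^sup>2 \<le> (cmod (p x))\<^sup>2" for x
      using g(2)[of x] by (simp add: norm_mult power_mono mult_left_le)
    have pg2: "integrable M (\<lambda>x. (cmod (p x * g x))\<^sup>2)"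
      by (rule Bochner_Integration.integrable_bound[OF p2])
        (use pg in auto)
    have pull: "integrable M (\<lambda>x. (cmod (h (\<psi> x)))\<^sup>2)"
      "(\<integral>x. (cmod (h (\<psi> x)))\<^sup>2 \<partial>M) = (\<integral>y. (cmod (h y))\<^sup>2 \<partial>\<sigma>)"
      if "integrable \<sigma> (\<lambda>y. (cmod (h y))\<^sup>2)" and [measurable]: "h \<in> borel_measurable (borel_Rn l)"
      for h :: "(nat \<Rightarrow> real) \<Rightarrow> complex"
      using that(1) by (simp_all add: integrable_distr_eq integral_distr flip: M(2))
    have prod: "integrable M (\<lambda>x. p x * g x * h (\<psi> x))"
      if "integrable \<sigma> (\<lambda>y. (cmod (h y))\<^sup>2)" and [measurable]: "h \<in> borel_measurable (borel_Rn l)"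
      for h :: "(nat \<Rightarrow> real) \<Rightarrow> complex"
      by (rule integral_mult_weighted_bound(1)[OF _ _ pg2 pull(1)[OF that] \<open>t > 0\<close>]) measurable
    have q2: "integrable \<sigma> (\<lambda>y. (cmod (q y))\<^sup>2)"
      by (rule integrable_polys_square[OF \<sigma> q])
    have h2: "integrable \<sigma> (\<lambda>y. (cmod (f y - q y))\<^sup>2)"
    proof (rule Bochner_Integration.integrable_bound)
      show "integrable \<sigma> (\<lambda>y. 2 * (cmod (f y))\<^sup>2 + 2 * (cmod (q y))\<^sup>2)"
        using f2 q2 by simp
      have "(cmod (f y - q y))\<^sup>2 \<le> 2 * (cmod (f y))\<^sup>2 + 2 * (cmod (q y))\<^sup>2" for y
      proof -
        have "(cmod (f y - q y))\<^sup>2 \<le> (cmod (f y) + cmod (q y))\<^sup>2"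
          by (intro power_mono norm_triangle_ineq4) simp
        also have "\<dots> \<le> 2 * (cmod (f y))\<^sup>2 + 2 * (cmod (q y))\<^sup>2"
          using sum_squares_bound[of "cmod (f y)" "cmod (q y)"] by (simp add: power2_sum)
        finally show ?thesis .
      qed
      then show "AE y in \<sigma>. norm ((cmod (f y - q y))\<^sup>2)
          \<le> norm (2 * (cmod (f y))\<^sup>2 + 2 * (cmod (q y))\<^sup>2)"
        by (intro AE_I2) simp
    qed measurable
    have pf: "integrable M (\<lambda>x. p x * (g x * f (\<psi> x)))"
      using prod[OF f2] by (simp add: mult.assoc)
    have pq: "integrable M (\<lambda>x. p x * (g x * q (\<psi> x)))"
      using prod[OF q2] by (simp add: mult.assoc)
    show "integrable M (\<lambda>x. p x * (g x * f (\<psi> x)))"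
      by (rule pf)
    have "(\<integral>x. p x * (g x * f (\<psi> x)) \<partial>M) - (\<integral>x. p x * (g x * q (\<psi> x)) \<partial>M)
        = (\<integral>x. p x * g x * (f (\<psi> x) - q (\<psi> x)) \<partial>M)"
      using pf pq by (simp flip: Bochner_Integration.integral_diff add: algebra_simps)
    also have "cmod \<dots> \<le> (t * (\<integral>x. (cmod (p x * g x))\<^sup>2 \<partial>M)
        + (\<integral>x. (cmod (f (\<psi> x) - q (\<psi> x)))\<^sup>2 \<partial>M) / t) / 2"
      by (rule integral_mult_weighted_bound(2)[OF _ _ pg2 _ \<open>t > 0\<close>])
        (use pull(1)[OF h2] in measurable)
    also have "\<dots> \<le> (t * (\<integral>x. (cmod (p x))\<^sup>2 \<partial>M) + (\<integral>y. (cmod (f y - q y))\<^sup>2 \<partial>\<sigma>) / t) / 2"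
      using integral_mono[OF pg2 p2 pg] pull(2)[OF h2] \<open>t > 0\<close> by (simp add: mult_left_mono)
    finally show "cmod ((\<integral>x. p x * (g x * f (\<psi> x)) \<partial>M) - (\<integral>x. p x * (g x * q (\<psi> x)) \<partial>M))
      \<le> (t * (\<integral>x. (cmod (p x))\<^sup>2 \<partial>M) + (\<integral>y. (cmod (f y - q y))\<^sup>2 \<partial>\<sigma>) / t) / 2" .
  qed

  have same: "(\<integral>x. p x * (g x * q (\<psi> x)) \<partial>\<nu>) = (\<integral>x. p x * (g x * q (\<psi> x)) \<partial>\<mu>)"
    if q: "q \<in> polys l" for q
  proof -
    obtain Q where Q: "Q \<in> polys n" "\<And>x. x \<in> Rn n \<Longrightarrow> q (\<psi> x) = Q x"
      using polys_compose_poly_map[OF q \<psi>] by metis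
    have "(\<integral>x. p x * (g x * q (\<psi> x)) \<partial>M) = (\<integral>x. (p x * Q x) * g x \<partial>M)"
      if "M \<in> moment_measures n" for M
      using Q(2) moment_measuresD(2)[OF that]
      by (intro Bochner_Integration.integral_cong) (auto simp: mult_ac)
    then show ?thesis
      using eq[OF polys_mult[OF p Q(1)]] \<mu> \<nu> by simp
  qed

  let ?I = "\<lambda>M. \<integral>x. p x * (g x * f (\<psi> x)) \<partial>M"
  have small: "cmod (?I \<nu> - ?I \<mu>) \<le> \<epsilon> * (S / 2 + 1)" if \<epsilon>: "\<epsilon> > 0" for \<epsilon>
  proof -
    have "f \<in> borel_measurable \<sigma> \<and> integrable \<sigma> (\<lambda>y. (cmod (f y))\<^sup>2)"
      using f2 by simp
    then obtain q where q: "q \<in> polys l" "sqrt (\<integral>y. (cmod (f y - q y))\<^sup>2 \<partial>\<sigma>) < \<epsilon>"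
      using dense \<epsilon> unfolding polys_dense_L2_def \<sigma>_def[symmetric] by blast
    define D where "D = (\<integral>y. (cmod (f y - q y))\<^sup>2 \<partial>\<sigma>)"
    have "D < \<epsilon>\<^sup>2"
      using q(2) \<epsilon> real_sqrt_less_iff[of D "\<epsilon>\<^sup>2"] by (simp add: D_def)
    \<comment> \<open>With weight \<open>t = \<epsilon>\<close> both terms of the bound are of order \<open>\<epsilon>\<close>.\<close>
    then have D: "D / \<epsilon> \<le> \<epsilon>"
      using \<epsilon> by (simp add: field_simps power2_eq_square)
    let ?J = "\<lambda>M. \<integral>x. p x * (g x * q (\<psi> x)) \<partial>M"
    have "cmod (?I \<nu> - ?I \<mu>) \<le> cmod (?I \<nu> - ?J \<nu>) + cmod (?I \<mu> - ?J \<mu>)"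
      using norm_triangle_ineq4[of "?I \<nu> - ?J \<nu>" "?I \<mu> - ?J \<mu>"] same[OF q(1)] by simp
    also have "\<dots> \<le> (\<epsilon> * (\<integral>x. (cmod (p x))\<^sup>2 \<partial>\<nu>) + D / \<epsilon>) / 2
        + (\<epsilon> * (\<integral>x. (cmod (p x))\<^sup>2 \<partial>\<mu>) + D / \<epsilon>) / 2"
      unfolding D_def using image
      by (intro add_mono replace(2) \<mu> \<nu> q(1) \<epsilon>) (auto simp: \<sigma>_def)
    also have "\<dots> = \<epsilon> * S / 2 + D / \<epsilon>"
      by (simp add: S_def algebra_simps add_divide_distrib)
    also have "\<dots> \<le> \<epsilon> * (S / 2 + 1)"
      using D by (simp add: algebra_simps)
    finally show ?thesis .
  qed
  have "S \<ge> 0"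
    by (simp add: S_def)
  have "cmod (?I \<nu> - ?I \<mu>) \<le> 0 + e" if "e > 0" for e
    using small[of "e / (S / 2 + 1)"] that \<open>S \<ge> 0\<close> by simp
  then have "cmod (?I \<nu> - ?I \<mu>) \<le> 0"
    by (rule field_le_epsilon)
  then show ?thesis
    by simp
qed


section \<open>Equality of the joint image measures\<close>

lemma integral_prod_factors_eq:
  fixes f :: "nat \<Rightarrow> (nat \<Rightarrow> real) \<Rightarrow> complex"
  assumes "\<mu> \<in> moment_measures n" "\<nu> \<in> moment_measures n" "moment_equiv n \<nu> \<mu>"
    and "\<And>j. j < r \<Longrightarrow> poly_map n (m j) (\<phi> j)"
    and "\<And>j. j < r \<Longrightarrow> strictly_determinate (m j) (distr \<mu> (borel_Rn (m j)) (\<phi> j))"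
    and "\<And>j. j < r \<Longrightarrow> f j \<in> borel_measurable (borel_Rn (m j))" "\<And>j y. cmod (f j y) \<le> 1"
    and "p \<in> polys n"
  shows "(\<integral>x. p x * (\<Prod>j<r. f j (\<phi> j x)) \<partial>\<nu>) = (\<integral>x. p x * (\<Prod>j<r. f j (\<phi> j x)) \<partial>\<mu>)"
  using assms(4-6,8)
proof (induction r arbitrary: p)
  case 0
  then show ?case
    using assms(3) by (simp add: moment_equiv_def)
next
  case (Suc r)
  have "(\<lambda>x. f j (\<phi> j x)) \<in> borel_measurable (borel_Rn n)" if "j < r" for j
    using that
    by (intro measurable_compose[OF measurable_poly_map[OF Suc.prems(1)] Suc.prems(3)]) auto
  then have "(\<lambda>x. \<Prod>j<r. f j (\<phi> j x)) \<in> borel_measurable (borel_Rn n)"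
    by (intro borel_measurable_prod) simp
  moreover have "cmod (\<Prod>j<r. f j (\<phi> j x)) \<le> 1" for x
    using assms(7) by (simp add: prod_le_1 flip: prod_norm)
  moreover have "distr \<nu> (borel_Rn (m r)) (\<phi> r) = distr \<mu> (borel_Rn (m r)) (\<phi> r)"
    using assms(1-3) Suc.prems(1,2)
    by (intro determinate_image_unique) (auto simp: strictly_determinate_def)
  moreover have "(\<integral>x. q x * (\<Prod>j<r. f j (\<phi> j x)) \<partial>\<nu>) = (\<integral>x. q x * (\<Prod>j<r. f j (\<phi> j x)) \<partial>\<mu>)"
    if "q \<in> polys n" for q
    using that Suc.prems(1-3) by (intro Suc.IH) auto
  moreover have "polys_dense_L2 (m r) (distr \<mu> (borel_Rn (m r)) (\<phi> r))"
    using Suc.prems(2) by (simp add: strictly_determinate_def)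
  ultimately have "(\<integral>x. p x * ((\<Prod>j<r. f j (\<phi> j x)) * f r (\<phi> r x)) \<partial>\<nu>)
      = (\<integral>x. p x * ((\<Prod>j<r. f j (\<phi> j x)) * f r (\<phi> r x)) \<partial>\<mu>)"
    using assms(1,2,7) Suc.prems(1,3,4) by (intro integral_eq_insert_factor[where l = "m r"]) auto
  then show ?case
    by simp
qed

text \<open>
  A finite measure on a finite product is determined by its values on boxes, and the indicator of the
  preimage of a box is a product of one bounded function for each block.
\<close>

lemma joint_image_unique:
  fixes r :: nat
  assumes "\<mu> \<in> moment_measures n" "\<nu> \<in> moment_measures n" "moment_equiv n \<nu> \<mu>"
    and \<phi>: "\<And>j. j < r \<Longrightarrow> poly_map n (m j) (\<phi> j)"
    and "\<And>j. j < r \<Longrightarrow> strictly_determinate (m j) (distr \<mu> (borel_Rn (m j)) (\<phi> j))"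
  shows "distr \<nu> (\<Pi>\<^sub>M j\<in>{..<r}. borel_Rn (m j)) (\<lambda>x. \<lambda>j\<in>{..<r}. \<phi> j x)
       = distr \<mu> (\<Pi>\<^sub>M j\<in>{..<r}. borel_Rn (m j)) (\<lambda>x. \<lambda>j\<in>{..<r}. \<phi> j x)"
    (is "distr \<nu> ?P ?T = distr \<mu> ?P ?T")
proof -
  have T: "?T \<in> M \<rightarrow>\<^sub>M ?P" if "M \<in> moment_measures n" for M
    using measurable_poly_map[OF \<phi>] moment_measuresD(1)[OF that]
    by (intro measurable_restrict) (simp cong: measurable_cong_sets)
  show ?thesis
  proof (rule measure_eqI_PiM_finite)
    fix A assume A: "\<And>j. j \<in> {..<r} \<Longrightarrow> A j \<in> sets (borel_Rn (m j))"
    let ?X = "?T -` (\<Pi>\<^sub>E j\<in>{..<r}. A j) \<inter> Rn n"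
    let ?f = "\<lambda>x. \<Prod>j<r. of_real (indicator (A j) (\<phi> j x)) :: complex"
    have box: "(\<Pi>\<^sub>E j\<in>{..<r}. A j) \<in> sets ?P"
      using A by (intro sets_PiM_I_finite) auto
    have emeasure: "emeasure (distr M ?P ?T) (\<Pi>\<^sub>E j\<in>{..<r}. A j) = ennreal (cmod (\<integral>x. ?f x \<partial>M))"
      if M: "M \<in> moment_measures n" for M
    proof -
      interpret finite_measure M
        by (rule finite_measure_moment_measures[OF M])
      have X: "?X \<in> sets M"
        using measurable_sets[OF T[OF M] box] by (simp add: moment_measuresD[OF M])
      have "?f x = of_real (indicator ?X x)" if "x \<in> Rn n" for x
        using that by (auto simp: indicator_def PiE_iff simp flip: of_real_prod)
      then have "(\<integral>x. ?f x \<partial>M) = (\<integral>x. of_real (indicator ?X x) \<partial>M)"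
        by (intro Bochner_Integration.integral_cong) (auto simp: moment_measuresD[OF M])
      also have "\<dots> = of_real (measure M ?X)"
        using X by (simp add: moment_measuresD(2)[OF M])
      finally show ?thesis
        by (simp add: emeasure_distr[OF T[OF M] box] moment_measuresD(2)[OF M] emeasure_eq_measure)
    qed
    have "(\<integral>x. 1 * ?f x \<partial>\<nu>) = (\<integral>x. 1 * ?f x \<partial>\<mu>)"
      using A
      by (intro integral_prod_factors_eq[OF assms, where
            f = "\<lambda>j y. of_real (indicator (A j) y)" and p = "\<lambda>_. 1"] polys_const)
        (auto intro!: borel_measurable_of_real borel_measurable_indicator simp: indicator_le_1)
    then show "emeasure (distr \<nu> ?P ?T) (\<Pi>\<^sub>E j\<in>{..<r}. A j)
        = emeasure (distr \<mu> ?P ?T) (\<Pi>\<^sub>E j\<in>{..<r}. A j)"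
      using emeasure assms(1,2) by simp
  next
    interpret finite_measure "distr \<nu> ?P ?T"
      by (intro finite_measure.finite_measure_distr finite_measure_moment_measures[OF assms(2)]
          T assms(2))
    show "range (\<lambda>_::nat. space ?P) \<subseteq> prod_algebra {..<r} (\<lambda>j. borel_Rn (m j))"
      by (auto simp: space_PiM intro!: prod_algebraI_finite)
    show "emeasure (distr \<nu> ?P ?T) (space ?P) \<noteq> \<infinity>" for i :: nat
      using emeasure_finite by simp
  qed auto
qed


section \<open>Separation of points by the joint map\<close>

text \<open>
  The block \<open>j\<close> and the position \<open>i\<close> do not depend on the vectors, so measurability and continuity of
  the concatenation reduce to those of single components.
\<close>

lemma concat_vec_component:
  assumes "k < (\<Sum>j<r. m j)"
  shows "\<exists>j<r. \<exists>i<m j. \<forall>v. concat_vec r m v k = v j i"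
proof -
  define ps where "ps = concat (map (\<lambda>j. map (Pair j) [0..<m j]) [0..<r])"
  have len: "length ps = (\<Sum>j<r. m j)"
    unfolding ps_def by (induction r) auto
  have "ps ! k \<in> set ps"
    using assms by (intro nth_mem) (simp only: len)
  then have "ps ! k \<in> (SIGMA j:{..<r}. {..<m j})"
    by (auto simp: ps_def)
  then obtain j i where ji: "ps ! k = (j, i)" "j < r" "i < m j"
    by (cases "ps ! k") auto
  have "concat (map (\<lambda>j. map (v j) [0..<m j]) [0..<r]) = map (\<lambda>(j, i). v j i) ps"
    for v :: "nat \<Rightarrow> nat \<Rightarrow> real"
    by (simp add: ps_def map_concat comp_def)
  then have "concat_vec r m v k = v j i" for v
    using assms ji(1) len by (simp add: concat_vec_def)
  then show ?thesis
    using ji(2,3) by blast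
qed

lemma concat_vec_outside: "\<not> k < (\<Sum>j<r. m j) \<Longrightarrow> concat_vec r m v k = 0"
  by (simp add: concat_vec_def)

lemma concat_vec_restrict: "concat_vec r m (\<lambda>j\<in>{..<r}. v j) = concat_vec r m v"
proof
  show "concat_vec r m (\<lambda>j\<in>{..<r}. v j) k = concat_vec r m v k" for k
  proof (cases "k < (\<Sum>j<r. m j)")
    case True
    obtain j i where "j < r" "\<And>v. concat_vec r m v k = v j i"
      using concat_vec_component[OF True] by blast
    then show ?thesis
      by simp
  qed (simp add: concat_vec_outside)
qed

lemma measurable_concat_vec:
  "concat_vec r m \<in> borel_measurable (\<Pi>\<^sub>M j\<in>{..<r}. borel_Rn (m j))" (is "_ \<in> borel_measurable ?P")
proof (rule measurable_coordinatewise_then_product)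
  show "(\<lambda>v. concat_vec r m v k) \<in> borel_measurable ?P" for k
  proof (cases "k < (\<Sum>j<r. m j)")
    case True
    obtain j i where "j < r" "\<And>v. concat_vec r m v k = v j i"
      using concat_vec_component[OF True] by blast
    then show ?thesis
      using measurable_compose[OF measurable_component_singleton[of j "{..<r}" "\<lambda>j. borel_Rn (m j)"]
          measurable_borel_Rn_component[of i "m j"]]
      by simp
  qed (simp add: concat_vec_outside)
qed

lemma continuous_on_concat_poly_maps:
  assumes "\<And>j. j < r \<Longrightarrow> poly_map n (m j) (\<phi> j)"
  shows "continuous_on (Rn n) (\<lambda>x. concat_vec r m (\<lambda>j. \<phi> j x))"
proof (rule continuous_on_coordinatewise_then_product)
  show "continuous_on (Rn n) (\<lambda>x. concat_vec r m (\<lambda>j. \<phi> j x) k)" for k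
  proof (cases "k < (\<Sum>j<r. m j)")
    case True
    obtain j i where "j < r" "i < m j" "\<And>v. concat_vec r m v k = v j i"
      using concat_vec_component[OF True] by blast
    then show ?thesis
      using continuous_on_poly_map_component[OF assms \<open>i < m j\<close>] by simp
  qed (simp add: concat_vec_outside)
qed

lemma compact_cube_Rn: "compact {x \<in> Rn n. \<forall>i<n. \<bar>x i\<bar> \<le> b}"
proof -
  let ?B = "\<lambda>i. if i < n then {-b..b} else {0::real}"
  have "{x \<in> Rn n. \<forall>i<n. \<bar>x i\<bar> \<le> b} = (\<Pi>\<^sub>E i\<in>UNIV. ?B i)"
  proof (intro set_eqI iffI)
    fix x assume "x \<in> (\<Pi>\<^sub>E i\<in>UNIV. ?B i)"
    then have "x i \<in> ?B i" for i
      by (simp add: PiE_iff)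
    then have "\<bar>x i\<bar> \<le> b" if "i < n" for i
      using that by (metis abs_le_iff atLeastAtMost_iff minus_le_iff)
    moreover have "x i = 0" if "i \<ge> n" for i
      using that \<open>\<And>i. x i \<in> ?B i\<close>[of i] by simp
    ultimately show "x \<in> {x \<in> Rn n. \<forall>i<n. \<bar>x i\<bar> \<le> b}"
      by (simp add: topspace_Euclidean_space)
  next
    fix x assume "x \<in> {x \<in> Rn n. \<forall>i<n. \<bar>x i\<bar> \<le> b}"
    then have "x i \<in> ?B i" for i
      by (cases "i < n") (auto simp: topspace_Euclidean_space abs_le_iff minus_le_iff)
    then show "x \<in> (\<Pi>\<^sub>E i\<in>UNIV. ?B i)"
      by (simp add: PiE_iff)
  qed
  moreover have "compactin (product_topology (\<lambda>_. euclidean) UNIV) (\<Pi>\<^sub>E i\<in>UNIV. ?B i)"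
    by (auto simp: compactin_PiE)
  ultimately show ?thesis
    by (metis compactin_euclidean_iff euclidean_product_topology)
qed

text \<open>
  A closed subset of \<open>\<real>\<^sup>n\<close> is a countable union of compact sets, so its continuous image is one too.
\<close>

lemma borel_image_closed:
  fixes \<Phi> :: "(nat \<Rightarrow> real) \<Rightarrow> nat \<Rightarrow> real"
  assumes "closedin (Euclidean_space n) C" "continuous_on (Rn n) \<Phi>"
  shows "\<Phi> ` C \<in> sets borel"
proof -
  let ?Q = "\<lambda>b::nat. {x \<in> Rn n. \<forall>i<n. \<bar>x i\<bar> \<le> real b}"
  have C: "closed C" "C \<subseteq> Rn n"
    using assms(1) by (auto simp: closedin_Euclidean_space_iff)
  have "\<exists>b. x \<in> ?Q b" if x: "x \<in> C" for x
  proof -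
    have "\<bar>x i\<bar> \<le> real (nat \<lceil>\<Sum>i<n. \<bar>x i\<bar>\<rceil>)" if "i < n" for i
    proof -
      have "\<bar>x i\<bar> \<le> (\<Sum>i<n. \<bar>x i\<bar>)"
        using that by (intro member_le_sum) auto
      then show ?thesis
        using real_nat_ceiling_ge order_trans by blast
    qed
    then show ?thesis
      using C(2) x by blast
  qed
  then have "C = (\<Union>b. ?Q b \<inter> C)"
    by blast
  then have "\<Phi> ` C = (\<Union>b. \<Phi> ` (?Q b \<inter> C))"
    by blast
  moreover have "closed (\<Phi> ` (?Q b \<inter> C))" for b
  proof -
    have "compact (?Q b \<inter> C)"
      using compact_Int_closed[OF compact_cube_Rn C(1)] .
    moreover have "continuous_on (?Q b \<inter> C) \<Phi>"
      using assms(2) by (rule continuous_on_subset) auto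
    ultimately show ?thesis
      by (intro compact_imp_closed compact_continuous_image)
  qed
  ultimately show ?thesis
    by (metis (no_types, lifting) borel_closed sets.countable_UN image_subset_iff)
qed


section \<open>Determinacy\<close>

theorem theorem16:
  fixes d r :: nat
    and m :: "nat \<Rightarrow> nat"
    and K :: "(nat \<Rightarrow> real) set"
    and \<mu> :: "(nat \<Rightarrow> real) measure"
    and \<phi> :: "nat \<Rightarrow> (nat \<Rightarrow> real) \<Rightarrow> nat \<Rightarrow> real"
  assumes "closedin (Euclidean_space d) K"
    and "\<mu> \<in> moment_measures_on d K"
    and "\<And>j. j < r \<Longrightarrow> poly_map d (m j) (\<phi> j)"
    and "inj_on (\<lambda>x. concat_vec r m (\<lambda>j. \<phi> j x)) K"
    and "\<And>j. j < r \<Longrightarrow> strictly_determinate (m j) (distr \<mu> (borel_Rn (m j)) (\<phi> j))"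
  shows "determinate_on d K \<mu>"
  unfolding determinate_on_def
proof (intro conjI ballI impI)
  fix \<nu> assume \<nu>_on: "\<nu> \<in> moment_measures_on d K" and equiv: "moment_equiv d \<nu> \<mu>"
  have \<mu>: "\<mu> \<in> moment_measures d" and \<nu>: "\<nu> \<in> moment_measures d"
    using assms(2) \<nu>_on by (auto simp: moment_measures_on_def)
  let ?\<Phi> = "\<lambda>x. concat_vec r m (\<lambda>j. \<phi> j x)"
  let ?P = "\<Pi>\<^sub>M j\<in>{..<r}. borel_Rn (m j)"
  let ?T = "\<lambda>x. \<lambda>j\<in>{..<r}. \<phi> j x"
  have T: "?T \<in> borel_Rn d \<rightarrow>\<^sub>M ?P"
    using measurable_poly_map[OF assms(3)] by (intro measurable_restrict) simp
  have \<Phi>: "?\<Phi> \<in> borel_measurable (borel_Rn d)"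
    using measurable_compose[OF T measurable_concat_vec] by (simp add: concat_vec_restrict)
  have image: "distr M borel ?\<Phi> = distr (distr M ?P ?T) borel (concat_vec r m)"
    if "M \<in> moment_measures d" for M
    using T moment_measuresD(1)[OF that]
    by (subst distr_distr[OF measurable_concat_vec])
      (simp_all add: comp_def concat_vec_restrict cong: measurable_cong_sets)
  have image_eq: "distr \<nu> borel ?\<Phi> = distr \<mu> borel ?\<Phi>"
    using joint_image_unique[OF \<mu> \<nu> equiv assms(3,5)] by (simp add: image[OF \<mu>] image[OF \<nu>])
  show "\<nu> = \<mu>"
  proof (rule measure_eqI_closed[OF \<nu> \<mu>])
    fix C assume C: "closedin (Euclidean_space d) C"
    define F where "F = ?\<Phi> ` (C \<inter> K)"
    have F: "F \<in> sets borel"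
      unfolding F_def using C assms(1)
      by (intro borel_image_closed[of d] continuous_on_concat_poly_maps[OF assms(3)]) auto
    have "emeasure M C = emeasure (distr M borel ?\<Phi>) F" if M: "M \<in> moment_measures_on d K" for M
    proof -
      have M': "M \<in> moment_measures d"
        using M by (simp add: moment_measures_on_def)
      have \<Phi>M: "?\<Phi> \<in> borel_measurable M"
        using \<Phi> moment_measuresD(1)[OF M'] by (simp cong: measurable_cong_sets)
      have "Rn d - (Rn d - C) = C"
        using closedin_subset[OF C] by blast
      moreover have "Rn d - C \<in> sets (borel_Rn d)"
        using C by (auto simp: sets_borel_Rn closedin_def)
      ultimately have "C \<in> sets M"
        by (metis moment_measuresD(1)[OF M'] sets.compl_sets space_borel_Rn)
      \<comment> \<open>Injectivity on \<open>K\<close> gives \<open>\<Phi>\<^sup>-\<^sup>1(\<Phi>(C \<inter> K)) \<inter> K = C \<inter> K\<close>.\<close>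
      moreover have "AE x in M. x \<in> C \<longleftrightarrow> x \<in> ?\<Phi> -` F \<inter> space M"
        using AE_in_closed_superset_of_support[OF M assms(1)] AE_space
      proof eventually_elim
        case (elim x)
        then show ?case
          using inj_onD[OF assms(4)] by (auto simp: F_def)
      qed
      ultimately have "emeasure M C = emeasure M (?\<Phi> -` F \<inter> space M)"
        using measurable_sets[OF \<Phi>M F] by (intro emeasure_eq_AE)
      then show ?thesis
        by (simp add: emeasure_distr \<Phi>M F)
    qed
    then show "emeasure \<nu> C = emeasure \<mu> C"
      using assms(2) \<nu>_on image_eq by simp
  qed
qed (rule assms(2))

end
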